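(* Let $x_1,y_1,x_2,y_2\in\mathbb{Z}$ be such that the points $O=(0,0)$, $(x_1,y_1)$, $(x_2,y_2)$ are the vertices of a non-degenerate triangle in $\mathbb{R}^2$. If the circumcenter and the centroid of this triangle both lie in $\mathbb{Z}^2$, then $\gcd(x_1,y_1,x_2,y_2)$ is a multiple of $3$.
   Context: A lattice triangle is a triangle in the plane $\mathbb{R}^2$ whose vertices have integer coordinates; triangles are assumed non-degenerate (the vertices are not collinear). A lattice point is a point of $\mathbb{Z}^2$. The circumcenter is the intersection of the perpendicular bisectors of the sides (the unique point equidistant from the three vertices), and the centroid is the intersection of the medians, i.e. $\frac13(v_1+v_2+v_3)$ for vertices $v_1,v_2,v_3$. *)

theory Defs
  imports "HOL-Analysis.Analysis"
begin

definition lattice_point :: "real^2 \<Rightarrow> bool" where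
  "lattice_point p \<longleftrightarrow> (\<forall>i. p $ i \<in> \<int>)"

definition perp_bisector :: "real^2 \<Rightarrow> real^2 \<Rightarrow> (real^2) set" where
  "perp_bisector a b = {p. (p - midpoint a b) \<bullet> (b - a) = 0}"

(* Meaningful only for non-collinear a, b, c, where the common point of the three
   perpendicular bisectors exists and is unique. *)
definition circumcenter :: "real^2 \<Rightarrow> real^2 \<Rightarrow> real^2 \<Rightarrow> real^2" where
  "circumcenter a b c =
     (THE p. p \<in> perp_bisector a b \<inter> perp_bisector b c \<inter> perp_bisector c a)"

definition centroid :: "real^2 \<Rightarrow> real^2 \<Rightarrow> real^2 \<Rightarrow> real^2" where
  "centroid a b c = (1 / 3) *\<^sub>R (a + b + c)"

end

theory Submission
  imports Defs
begin

text \<open>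
  Let \<open>(u, v)\<close> be the circumcenter. As it lies on the perpendicular bisectors of the two sides
  at the origin (lemma \<open>circumcenter_in_perp_bisectors\<close>), \<open>2 (u x\<^sub>i + v y\<^sub>i) = x\<^sub>i\<^sup>2 + y\<^sub>i\<^sup>2\<close> for \<open>i = 1, 2\<close>. Integrality of the
  centroid means \<open>x\<^sub>1 + x\<^sub>2 \<equiv> y\<^sub>1 + y\<^sub>2 \<equiv> 0\<close> modulo 3. If \<open>u\<close> and \<open>v\<close> are integers, adding
  the two equations gives \<open>0 \<equiv> x\<^sub>1\<^sup>2 + y\<^sub>1\<^sup>2 + x\<^sub>2\<^sup>2 + y\<^sub>2\<^sup>2 \<equiv> 2 (x\<^sub>1\<^sup>2 + y\<^sub>1\<^sup>2)\<close>, and since \<open>-1\<close> is not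
  a square modulo 3 (lemma \<open>three_dvd_sum_squares\<close>), both \<open>x\<^sub>1\<close> and \<open>y\<^sub>1\<close> are divisible by 3, hence so are \<open>x\<^sub>2\<close> and \<open>y\<^sub>2\<close>.
\<close>

lemma perp_bisector_iff:
  fixes a b p :: "real^2"
  shows "p \<in> perp_bisector a b \<longleftrightarrow>
    2 * (p$1 * (b$1 - a$1) + p$2 * (b$2 - a$2)) = (b$1)\<^sup>2 + (b$2)\<^sup>2 - (a$1)\<^sup>2 - (a$2)\<^sup>2"
proof -
  have "4 * ((p - midpoint a b) \<bullet> (b - a)) =
      2 * (2 * (p$1 * (b$1 - a$1) + p$2 * (b$2 - a$2))
        - ((b$1)\<^sup>2 + (b$2)\<^sup>2 - (a$1)\<^sup>2 - (a$2)\<^sup>2))"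
    by (simp add: midpoint_def inner_vec_def sum_2 field_simps power2_eq_square)
  then show ?thesis
    unfolding perp_bisector_def mem_Collect_eq by auto
qed

lemma det_nonzero_if_not_collinear:
  fixes a b c :: "real^2"
  assumes "\<not> collinear {a, b, c}"
  shows "(b$1 - a$1) * (c$2 - a$2) - (c$1 - a$1) * (b$2 - a$2) \<noteq> 0"
proof
  assume eq: "(b$1 - a$1) * (c$2 - a$2) - (c$1 - a$1) * (b$2 - a$2) = 0"
  define x y where "x = b - a" and "y = c - a"
  have x0: "x \<noteq> 0"
    using assms by (auto simp: x_def)
  have xy: "x$1 * y$2 = y$1 * x$2"
    using eq by (simp add: x_def y_def)
  have "\<exists>k. y = k *\<^sub>R x"
  proof (cases "x$1 = 0")
    case True
    then have "x$2 \<noteq> 0"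
      using x0 by (auto simp: vec_eq_iff forall_2)
    then have "y = (y$2 / x$2) *\<^sub>R x"
      using True xy by (auto simp: vec_eq_iff forall_2)
    then show ?thesis ..
  next
    case False
    then have "y = (y$1 / x$1) *\<^sub>R x"
      using xy by (auto simp: vec_eq_iff forall_2 field_simps)
    then show ?thesis ..
  qed
  then have "collinear {0, x, y}"
    by (auto simp: collinear_lemma)
  moreover have "{a, b, c} = {b, a, c}"
    by auto
  ultimately show False
    using assms collinear_3[of b a c] by (simp add: x_def y_def)
qed

text \<open>
  The definite description defining the circumcenter is meaningful for a non-degenerate triangle:
  two of the bisector equations form a linear system with nonzero determinant, and they imply
  the third.
\<close>
lemma circumcenter_in_perp_bisectors:
  assumes "\<not> collinear {a, b, c}"
  shows "circumcenter a b c \<in> perp_bisector a b \<inter> perp_bisector b c \<inter> perp_bisector c a"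
  unfolding circumcenter_def
proof (rule theI')
  define k l m n where "k = b$1 - a$1" and "l = b$2 - a$2" and "m = c$1 - a$1" and "n = c$2 - a$2"
  define d where "d = k * n - m * l"
  define s where "s = ((b$1)\<^sup>2 + (b$2)\<^sup>2 - (a$1)\<^sup>2 - (a$2)\<^sup>2) / 2"
  define t where "t = ((c$1)\<^sup>2 + (c$2)\<^sup>2 - (a$1)\<^sup>2 - (a$2)\<^sup>2) / 2"
  have d: "d \<noteq> 0"
    using det_nonzero_if_not_collinear[OF assms] by (simp add: d_def k_def l_def m_def n_def)
  \<comment> \<open>The equation for \<open>b c\<close> is the difference of those for \<open>a c\<close> and \<open>a b\<close>, so it can be dropped.\<close>
  have iff: "p \<in> perp_bisector a b \<inter> perp_bisector b c \<inter> perp_bisector c a \<longleftrightarrow>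
      p$1 * k + p$2 * l = s \<and> p$1 * m + p$2 * n = t" for p
  proof -
    define e f where "e = p$1 * k + p$2 * l" and "f = p$1 * m + p$2 * n"
    have "p$1 * (b$1 - a$1) + p$2 * (b$2 - a$2) = e"
      "p$1 * (c$1 - b$1) + p$2 * (c$2 - b$2) = f - e"
      "p$1 * (a$1 - c$1) + p$2 * (a$2 - c$2) = - f"
      by (simp_all add: e_def f_def k_def l_def m_def n_def algebra_simps)
    then show ?thesis
      unfolding Int_iff perp_bisector_iff s_def t_def e_def[symmetric] f_def[symmetric] by auto
  qed
  \<comment> \<open>The solution given by Cramer's rule.\<close>
  define q :: "real^2" where "q = vector [(s * n - t * l) / d, (t * k - s * m) / d]"
  have sol: "p$1 * k + p$2 * l = s \<and> p$1 * m + p$2 * n = t \<longleftrightarrow> p = q" for p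
  proof
    assume eqs: "p$1 * k + p$2 * l = s \<and> p$1 * m + p$2 * n = t"
    have "p$1 * d = (p$1 * k + p$2 * l) * n - (p$1 * m + p$2 * n) * l"
      "p$2 * d = (p$1 * m + p$2 * n) * k - (p$1 * k + p$2 * l) * m"
      by (simp_all add: d_def algebra_simps)
    then have "p$1 * d = s * n - t * l" "p$2 * d = t * k - s * m"
      using eqs by simp_all
    then show "p = q"
      using d by (simp add: q_def vec_eq_iff forall_2 eq_divide_eq)
  next
    assume "p = q"
    have "(s * n - t * l) * k + (t * k - s * m) * l = s * d"
      "(s * n - t * l) * m + (t * k - s * m) * n = t * d"
      by (simp_all add: d_def algebra_simps)
    then show "p$1 * k + p$2 * l = s \<and> p$1 * m + p$2 * n = t"
      using d by (simp add: \<open>p = q\<close> q_def flip: add_divide_distrib)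
  qed
  show "\<exists>!p. p \<in> perp_bisector a b \<inter> perp_bisector b c \<inter> perp_bisector c a"
    unfolding iff sol by simp
qed

lemma three_dvd_sum_squares:
  fixes x y :: int
  assumes "3 dvd x\<^sup>2 + y\<^sup>2"
  shows "3 dvd x" and "3 dvd y"
proof -
  have sq: "z\<^sup>2 mod 3 = (if 3 dvd z then 0 else 1)" for z :: int
  proof -
    have "z mod 3 = 0 \<or> z mod 3 = 1 \<or> z mod 3 = 2"
      by presburger
    moreover have "z\<^sup>2 mod 3 = (z mod 3)\<^sup>2 mod 3"
      by (simp add: power_mod)
    ultimately show ?thesis
      unfolding dvd_eq_mod_eq_0 by (elim disjE; simp)
  qed
  have "(x\<^sup>2 mod 3 + y\<^sup>2 mod 3) mod 3 = 0"
    by (simp only: mod_add_eq dvd_imp_mod_0[OF assms])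
  then show "3 dvd x" and "3 dvd y"
    unfolding sq by (auto split: if_splits)
qed

theorem theorem1:
  fixes x1 y1 x2 y2 :: int and P1 P2 :: "real^2"
  assumes P1: "P1 = vector [of_int x1, of_int y1]"
    and P2: "P2 = vector [of_int x2, of_int y2]"
    and nondegenerate: "\<not> collinear {0, P1, P2}"
    and circumcenter: "lattice_point (circumcenter 0 P1 P2)"
    and centroid: "lattice_point (centroid 0 P1 P2)"
  shows "3 dvd Gcd {x1, y1, x2, y2}"
proof -
  define C where "C = circumcenter 0 P1 P2"
  obtain u v where uv: "C$1 = of_int u" "C$2 = of_int v"
    using circumcenter unfolding lattice_point_def C_def by (metis Ints_cases)
  have "C \<in> perp_bisector 0 P1" "C \<in> perp_bisector P2 0"
    using circumcenter_in_perp_bisectors[OF nondegenerate] by (auto simp: C_def)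
  then have "real_of_int (2 * (u * x1 + v * y1)) = of_int (x1\<^sup>2 + y1\<^sup>2)"
    "real_of_int (2 * (u * x2 + v * y2)) = of_int (x2\<^sup>2 + y2\<^sup>2)"
    unfolding perp_bisector_iff by (simp_all add: P1 P2 uv)
  then have bisect: "2 * (u * x1 + v * y1) = x1\<^sup>2 + y1\<^sup>2" "2 * (u * x2 + v * y2) = x2\<^sup>2 + y2\<^sup>2"
    unfolding of_int_eq_iff by auto
  obtain m n where "centroid 0 P1 P2 $ 1 = of_int m" "centroid 0 P1 P2 $ 2 = of_int n"
    using centroid unfolding lattice_point_def by (metis Ints_cases)
  then have "real_of_int (x1 + x2) = of_int (3 * m)" "real_of_int (y1 + y2) = of_int (3 * n)"
    by (simp_all add: centroid_def P1 P2)
  then have sums: "x2 = 3 * m - x1" "y2 = 3 * n - y1"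
    unfolding of_int_eq_iff by auto
  \<comment> \<open>The sum of the two bisector equations, with \<open>x2\<close> and \<open>y2\<close> eliminated.\<close>
  have "2 * (x1\<^sup>2 + y1\<^sup>2) = 3 * (2 * (u * m + v * n) - 3 * m\<^sup>2 - 3 * n\<^sup>2 + 2 * m * x1 + 2 * n * y1)"
    using bisect unfolding sums by (simp add: power2_eq_square algebra_simps)
  then have "3 dvd x1\<^sup>2 + y1\<^sup>2"
    by presburger
  then have "3 dvd x1" "3 dvd y1"
    by (rule three_dvd_sum_squares)+
  moreover from this have "3 dvd x2" "3 dvd y2"
    unfolding sums by auto
  ultimately show ?thesis
    by (auto intro: Gcd_greatest)
qed

end
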